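(* Let $(K,\Sigma)$ be a tight FFCC pair for $\mathbf H$ and $\bar t=\langle t_n:n<\omega\rangle\in\mathrm{PC}^{\mathtt{tt}}_\infty(K,\Sigma)$. Suppose that $\bar D=\langle D_n:n<\omega\rangle\in\mathrm{suf}^*_{\bar t}$ satisfies $\bar D\circledast\bar D=\bar D$, and that $\bar A=\langle A_n:n<\omega\rangle$ satisfies $A_n\in D_n$ for all $n<\omega$. Then there is $\bar s=\langle s_i:i<\omega\rangle\in\mathrm{PC}^{\mathtt{tt}}_\infty(K,\Sigma)$ such that $\bar s\ge\bar t$, $m^{s_0}_{\mathrm{dn}}=m^{t_0}_{\mathrm{dn}}$, and for all $i,k<\omega$: if $s_i\in\Sigma^{\mathtt{tt}}(\bar t\upharpoonleft k)$, then $\mathrm{pos}^{\mathtt{tt}}(\bar s\upharpoonleft i)\subseteq A_k$.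
   Context: Notation: an integer $n$ is identified with $\{0,\dots,n-1\}$; $[n,m)=\{k\in\omega:n\le k<m\}$. Fix $\mathbf H$ with domain $\omega$, each $\mathbf H(i)$ finite non-empty; $\mathcal F_{\mathbf H}$ is the set of finite non-empty functions $f$ with $\mathrm{dom}(f)\subseteq\omega$, $f(i)\in\mathbf H(i)$. An FP creature for $\mathbf H$ is a tuple $t=(\mathrm{nor}[t],\mathrm{val}[t],\mathrm{dis}[t],m^t_{\mathrm{dn}},m^t_{\mathrm{up}})$ with $\mathrm{nor}[t]\ge0$ real, $\mathrm{dis}[t]$ arbitrary, $m^t_{\mathrm{dn}}<m^t_{\mathrm{up}}<\omega$, $\mathrm{val}[t]$ a non-empty finite subset of $\mathcal F_{\mathbf H}$ whose members have domains inside $[m^t_{\mathrm{dn}},m^t_{\mathrm{up}})$. A tight FFCC pair for $\mathbf H$ is a pair $(K,\Sigma)$ with: $K$ a countable family of FP creatures for $\mathbf H$; for each $m$, $\{t\in K:m^t_{\mathrm{up}}\le m\}$ finite and $\{t\in K:m^t_{\mathrm{dn}}\ge m,\ \mathrm{nor}[t]\ge m\}$ infinite; $\Sigma$ a function defined exactly on the finite sequences $(t_0,\dots,t_n)$ of members of $K$ with $m^{t_\ell}_{\mathrm{up}}=m^{t_{\ell+1}}_{\mathrm{dn}}$ ($\ell<n$), with values non-empty subsets of $K$; if $t\in\Sigma(t_0,\dots,t_n)$ then $m^t_{\mathrm{dn}}=m^{t_0}_{\mathrm{dn}}$, $m^t_{\mathrm{up}}=m^{t_n}_{\mathrm{up}}$,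 and every $f\in\mathrm{val}[t]$ has $\mathrm{dom}(f)\subseteq\bigcup_{\ell\le n}[m^{t_\ell}_{\mathrm{dn}},m^{t_\ell}_{\mathrm{up}})$ and $f\upharpoonright[m^{t_\ell}_{\mathrm{dn}},m^{t_\ell}_{\mathrm{up}})\in\mathrm{val}[t_\ell]$ for all $\ell\le n$; $t\in\Sigma(t)$ for $t\in K$; if $\bar t_0,\dots,\bar t_n\in\mathrm{dom}(\Sigma)$ and their concatenation $\bar t\in\mathrm{dom}(\Sigma)$ then $\Sigma(s_0,\dots,s_n)\subseteq\Sigma(\bar t)$ whenever $s_\ell\in\Sigma(\bar t_\ell)$; and if $s_0,s_1\in K$, $m^{s_0}_{\mathrm{up}}=m^{s_1}_{\mathrm{dn}}$, $f_0\in\mathrm{val}[s_0]$, $f_1\in\mathrm{val}[s_1]$, then $f_0\cup f_1\in\mathrm{val}[s]$ for some $s\in\Sigma(s_0,s_1)$. Outside $\mathrm{dom}(\Sigma)$ set $\Sigma(\cdot)=\emptyset$. $\mathrm{PC}^{\mathtt{tt}}_\infty(K,\Sigma)$ is the set of sequences $\bar t=\langle t_n\rangle$ of members of $K$ with $m^{t_n}_{\mathrm{up}}=m^{t_{n+1}}_{\mathrm{dn}}$ and $\lim_n\mathrm{nor}[t_n]=\infty$. $\bar t\le\bar s$ means there are non-empty finite $u_n\subseteq\omega$ with $\max u_n<\min u_{n+1}$ and $s_n\in\Sigma(\bar t\upharpoonright u_n)$ ($\bar t\upharpoonright u$ = the tuple $(t_i:i\in u)$ increasingly). $\bar t\upharpoonleft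 n=\langle t_{n+k}:k<\omega\rangle$; $\Sigma^{\mathtt{tt}}(\bar t)=\bigcup_n\Sigma(t_0,\dots,t_n)$; $\mathrm{pos}^{\mathtt{tt}}(\bar t)=\bigcup\{\mathrm{val}[s]:s\in\Sigma^{\mathtt{tt}}(\bar t)\}$. For $f\in\mathrm{pos}^{\mathtt{tt}}(\bar t\upharpoonleft n)$, $x_f$ is the unique $m>n$ with $f\in\mathrm{val}[s]$ for some $s\in\Sigma(t_n,\dots,t_{m-1})$; for $A\subseteq\mathcal F_{\mathbf H}$, $f\circledast A=\{g\in\mathrm{pos}^{\mathtt{tt}}(\bar t\upharpoonleft x_f):f\cup g\in A\}$. $\mathrm{suf}_{\bar t}$ is the set of sequences $\bar D=\langle D_n:n<\omega\rangle$ with each $D_n$ a non-principal ultrafilter on $\mathrm{pos}^{\mathtt{tt}}(\bar t\upharpoonleft n)$. For $\bar D\in\mathrm{suf}_{\bar t}$ and $A\subseteq\mathrm{pos}^{\mathtt{tt}}(\bar t\upharpoonleft n)$, $\mathrm{set}^n_{\bar t}(A,\bar D)=\{f\in\mathrm{pos}^{\mathtt{tt}}(\bar t\upharpoonleft n):f\circledast A\in D_{x_f}\}$. For $\bar D^1,\bar D^2\in\mathrm{suf}_{\bar t}$, $\bar D^1\circledast\bar D^2=\langle D_n\rangle$ where $D_n=\{A\subseteq\mathrm{pos}^{\mathtt{tt}}(\bar t\upharpoonleft n):\mathrm{set}^n_{\bar t}(A,\bar D^1)\in D^2_n\}$. $\mathcal B^n_{\bar t}$ is the family of $B\subseteq\mathrm{pos}^{\mathtt{tt}}(\bar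 t\upharpoonleft n)$ for which there is $M$ such that $\mathrm{val}[s]\cap B\ne\emptyset$ for all $s\in\Sigma^{\mathtt{tt}}(\bar t\upharpoonleft n)$ with $\mathrm{nor}[s]\ge M$. $\mathrm{suf}^*_{\bar t}$ is the set of $\bar D\in\mathrm{suf}_{\bar t}$ with $\mathcal B^n_{\bar t}\subseteq D_n$ for all $n$. *)

theory Defs
  imports Complex_Main "HOL-Library.Countable_Set"
begin

type_synonym 'v pfun = "nat \<rightharpoonup> 'v"

definition FH :: "(nat \<Rightarrow> 'v set) \<Rightarrow> 'v pfun set" where
  "FH H = {f. finite (dom f) \<and> dom f \<noteq> {} \<and> (\<forall>i v. f i = Some v \<longrightarrow> v \<in> H i)}"

text \<open>The component \<open>dis\<close> is unconstrained, hence of an arbitrary type.\<close>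

record ('v, 'd) creature =
  nor :: real
  val :: "'v pfun set"
  dis :: 'd
  m_dn :: nat
  m_up :: nat

definition FP_creature :: "(nat \<Rightarrow> 'v set) \<Rightarrow> ('v, 'd) creature \<Rightarrow> bool" where
  "FP_creature H t \<longleftrightarrow>
     0 \<le> nor t \<and> m_dn t < m_up t \<and>
     val t \<noteq> {} \<and> finite (val t) \<and> val t \<subseteq> FH H \<and>
     (\<forall>f\<in>val t. dom f \<subseteq> {m_dn t..<m_up t})"

definition matching :: "('v, 'd) creature list \<Rightarrow> bool" where
  "matching ts \<longleftrightarrow> (\<forall>l. Suc l < length ts \<longrightarrow> m_up (ts ! l) = m_dn (ts ! Suc l))"

definition Sigma_dom :: "('v, 'd) creature set \<Rightarrow> ('v, 'd) creature list set" where
  "Sigma_dom K = {ts. ts \<noteq> [] \<and> set ts \<subseteq> K \<and> matching ts}"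

text \<open>The partial function \<open>\<Sigma>\<close> with domain \<^term>\<open>Sigma_dom K\<close> is represented by a total function
  on lists taking the value \<open>{}\<close> exactly outside that domain. In the last clause the domains
  of \<open>f0\<close> and \<open>f1\<close> are disjoint, so \<open>++\<close> is the union of functions.\<close>

definition tight_FFCC ::
  "(nat \<Rightarrow> 'v set) \<Rightarrow> ('v, 'd) creature set \<Rightarrow>
   (('v, 'd) creature list \<Rightarrow> ('v, 'd) creature set) \<Rightarrow> bool" where
  "tight_FFCC H K \<Sigma> \<longleftrightarrow>
     countable K \<and> (\<forall>t\<in>K. FP_creature H t) \<and>
     (\<forall>m. finite {t \<in> K. m_up t \<le> m}) \<and>
     (\<forall>m. infinite {t \<in> K. m \<le> m_dn t \<and> real m \<le> nor t}) \<and>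
     (\<forall>ts\<in>Sigma_dom K. \<Sigma> ts \<noteq> {} \<and> \<Sigma> ts \<subseteq> K) \<and>
     (\<forall>ts. ts \<notin> Sigma_dom K \<longrightarrow> \<Sigma> ts = {}) \<and>
     (\<forall>ts\<in>Sigma_dom K. \<forall>t\<in>\<Sigma> ts.
        m_dn t = m_dn (hd ts) \<and> m_up t = m_up (last ts) \<and>
        (\<forall>f\<in>val t. dom f \<subseteq> (\<Union>r\<in>set ts. {m_dn r..<m_up r}) \<and>
                   (\<forall>r\<in>set ts. f |` {m_dn r..<m_up r} \<in> val r))) \<and>
     (\<forall>t\<in>K. t \<in> \<Sigma> [t]) \<and>
     (\<forall>tss ss. tss \<noteq> [] \<and> set tss \<subseteq> Sigma_dom K \<and> concat tss \<in> Sigma_dom K \<and>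
        list_all2 (\<lambda>s ts. s \<in> \<Sigma> ts) ss tss \<longrightarrow> \<Sigma> ss \<subseteq> \<Sigma> (concat tss)) \<and>
     (\<forall>s0\<in>K. \<forall>s1\<in>K. m_up s0 = m_dn s1 \<longrightarrow>
        (\<forall>f0\<in>val s0. \<forall>f1\<in>val s1. \<exists>s\<in>\<Sigma> [s0, s1]. f0 ++ f1 \<in> val s))"

definition PC_tt :: "('v, 'd) creature set \<Rightarrow> (nat \<Rightarrow> ('v, 'd) creature) set" where
  "PC_tt K = {t. (\<forall>n. t n \<in> K) \<and> (\<forall>n. m_up (t n) = m_dn (t (Suc n))) \<and>
                 filterlim (\<lambda>n. nor (t n)) at_top sequentially}"

definition PC_le ::
  "(('v, 'd) creature list \<Rightarrow> ('v, 'd) creature set) \<Rightarrow>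
   (nat \<Rightarrow> ('v, 'd) creature) \<Rightarrow> (nat \<Rightarrow> ('v, 'd) creature) \<Rightarrow> bool" where
  "PC_le \<Sigma> t s \<longleftrightarrow>
     (\<exists>u :: nat \<Rightarrow> nat set.
        (\<forall>n. finite (u n) \<and> u n \<noteq> {} \<and> Max (u n) < Min (u (Suc n))) \<and>
        (\<forall>n. s n \<in> \<Sigma> (map t (sorted_list_of_set (u n)))))"

definition shift :: "(nat \<Rightarrow> 'a) \<Rightarrow> nat \<Rightarrow> nat \<Rightarrow> 'a" where
  "shift t n = (\<lambda>k. t (n + k))"

definition Sigma_tt ::
  "(('v, 'd) creature list \<Rightarrow> ('v, 'd) creature set) \<Rightarrow>
   (nat \<Rightarrow> ('v, 'd) creature) \<Rightarrow> ('v, 'd) creature set" where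
  "Sigma_tt \<Sigma> t = (\<Union>n. \<Sigma> (map t [0..<Suc n]))"

definition pos_tt ::
  "(('v, 'd) creature list \<Rightarrow> ('v, 'd) creature set) \<Rightarrow>
   (nat \<Rightarrow> ('v, 'd) creature) \<Rightarrow> 'v pfun set" where
  "pos_tt \<Sigma> t = (\<Union>s\<in>Sigma_tt \<Sigma> t. val s)"

text \<open>The number \<open>x\<^sub>f\<close> for \<^term>\<open>f \<in> pos_tt \<Sigma> (shift t n)\<close>; see \<open>x_of_unique\<close> below.\<close>

definition x_of ::
  "(('v, 'd) creature list \<Rightarrow> ('v, 'd) creature set) \<Rightarrow>
   (nat \<Rightarrow> ('v, 'd) creature) \<Rightarrow> nat \<Rightarrow> 'v pfun \<Rightarrow> nat" where
  "x_of \<Sigma> t n f = (THE m. n < m \<and> (\<exists>s\<in>\<Sigma> (map t [n..<m]). f \<in> val s))"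

text \<open>In the next definition \<^term>\<open>f ++ g\<close> is \<open>f \<union> g\<close>: for \<open>f \<in> pos_tt \<Sigma> (shift t n)\<close> the domain of
  \<open>f\<close> lies below \<open>m_dn (t x\<^sub>f)\<close>, and that of \<open>g\<close> at or above it.\<close>

definition f_conv ::
  "(('v, 'd) creature list \<Rightarrow> ('v, 'd) creature set) \<Rightarrow>
   (nat \<Rightarrow> ('v, 'd) creature) \<Rightarrow> nat \<Rightarrow> 'v pfun \<Rightarrow> 'v pfun set \<Rightarrow> 'v pfun set" where
  "f_conv \<Sigma> t n f A = {g \<in> pos_tt \<Sigma> (shift t (x_of \<Sigma> t n f)). f ++ g \<in> A}"

definition ultrafilter_on :: "'a set \<Rightarrow> 'a set set \<Rightarrow> bool" where
  "ultrafilter_on X D \<longleftrightarrow>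
     D \<subseteq> Pow X \<and> X \<in> D \<and> {} \<notin> D \<and>
     (\<forall>A\<in>D. \<forall>B\<in>D. A \<inter> B \<in> D) \<and>
     (\<forall>A\<in>D. \<forall>B. A \<subseteq> B \<and> B \<subseteq> X \<longrightarrow> B \<in> D) \<and>
     (\<forall>A. A \<subseteq> X \<longrightarrow> A \<in> D \<or> X - A \<in> D)"

definition principal_on :: "'a set \<Rightarrow> 'a set set \<Rightarrow> bool" where
  "principal_on X D \<longleftrightarrow> (\<exists>x\<in>X. D = {A. A \<subseteq> X \<and> x \<in> A})"

definition suf ::
  "(('v, 'd) creature list \<Rightarrow> ('v, 'd) creature set) \<Rightarrow>
   (nat \<Rightarrow> ('v, 'd) creature) \<Rightarrow> (nat \<Rightarrow> 'v pfun set set) set" where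
  "suf \<Sigma> t = {D. \<forall>n. ultrafilter_on (pos_tt \<Sigma> (shift t n)) (D n) \<and>
                      \<not> principal_on (pos_tt \<Sigma> (shift t n)) (D n)}"

definition set_conv ::
  "(('v, 'd) creature list \<Rightarrow> ('v, 'd) creature set) \<Rightarrow>
   (nat \<Rightarrow> ('v, 'd) creature) \<Rightarrow> nat \<Rightarrow> 'v pfun set \<Rightarrow> (nat \<Rightarrow> 'v pfun set set) \<Rightarrow>
   'v pfun set" where
  "set_conv \<Sigma> t n A D =
     {f \<in> pos_tt \<Sigma> (shift t n). f_conv \<Sigma> t n f A \<in> D (x_of \<Sigma> t n f)}"

definition suf_prod ::
  "(('v, 'd) creature list \<Rightarrow> ('v, 'd) creature set) \<Rightarrow>
   (nat \<Rightarrow> ('v, 'd) creature) \<Rightarrow> (nat \<Rightarrow> 'v pfun set set) \<Rightarrow> (nat \<Rightarrow> 'v pfun set set) \<Rightarrow>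
   (nat \<Rightarrow> 'v pfun set set)" where
  "suf_prod \<Sigma> t D1 D2 =
     (\<lambda>n. {A. A \<subseteq> pos_tt \<Sigma> (shift t n) \<and> set_conv \<Sigma> t n A D1 \<in> D2 n})"

definition B_fam ::
  "(('v, 'd) creature list \<Rightarrow> ('v, 'd) creature set) \<Rightarrow>
   (nat \<Rightarrow> ('v, 'd) creature) \<Rightarrow> nat \<Rightarrow> 'v pfun set set" where
  "B_fam \<Sigma> t n =
     {B. B \<subseteq> pos_tt \<Sigma> (shift t n) \<and>
         (\<exists>M::real. \<forall>s\<in>Sigma_tt \<Sigma> (shift t n). M \<le> nor s \<longrightarrow> val s \<inter> B \<noteq> {})}"

definition suf_star ::
  "(('v, 'd) creature list \<Rightarrow> ('v, 'd) creature set) \<Rightarrow>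
   (nat \<Rightarrow> ('v, 'd) creature) \<Rightarrow> (nat \<Rightarrow> 'v pfun set set) set" where
  "suf_star \<Sigma> t = {D \<in> suf \<Sigma> t. \<forall>n. B_fam \<Sigma> t n \<subseteq> D n}"

lemma x_of_unique:
  assumes K: "tight_FFCC H K \<Sigma>" and t: "t \<in> PC_tt K"
    and f: "f \<in> pos_tt \<Sigma> (shift t n)"
  shows "\<exists>!m. n < m \<and> (\<exists>s\<in>\<Sigma> (map t [n..<m]). f \<in> val s)"
proof (rule ex_ex1I)
  obtain k s where ks: "s \<in> \<Sigma> (map (shift t n) [0..<Suc k])" "f \<in> val s"
    using f unfolding pos_tt_def Sigma_tt_def by blast
  have "map (shift t n) [0..<Suc k] = map t [n..<n + Suc k]"
    by (rule nth_equalityI) (auto simp: shift_def simp del: upt_Suc)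
  with ks show "\<exists>m. n < m \<and> (\<exists>s\<in>\<Sigma> (map t [n..<m]). f \<in> val s)"
    by (intro exI[of _ "n + Suc k"]) auto
next
  have tK: "t i \<in> K" and tm: "m_up (t i) = m_dn (t (Suc i))" for i
    using t unfolding PC_tt_def by auto
  have lt: "m_dn (t i) < m_up (t i)" for i
    using K tK[of i] unfolding tight_FFCC_def FP_creature_def by simp
  have mono: "i < j \<Longrightarrow> m_up (t i) \<le> m_dn (t j)" for i j
  proof (induction j)
    case (Suc j)
    then show ?case using tm lt[of j] by (cases "i = j") (auto simp: less_Suc_eq)
  qed simp
  have dm: "map t [n..<m] \<in> Sigma_dom K" if "n < m" for m
    using that tK tm by (auto simp: Sigma_dom_def matching_def)
  have restr: "dom f \<subseteq> (\<Union>r\<in>set ts. {m_dn r..<m_up r}) \<and>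
      (\<forall>r\<in>set ts. f |` {m_dn r..<m_up r} \<in> val r)"
    if "ts \<in> Sigma_dom K" "s \<in> \<Sigma> ts" "f \<in> val s" for ts s
    using K that unfolding tight_FFCC_def by simp
  have FP: "FP_creature H (t i)" for i
    using K tK unfolding tight_FFCC_def by simp
  have no: False
    if m: "n < m" "m < m'" and s: "s \<in> \<Sigma> (map t [n..<m])" "f \<in> val s"
      and s': "s' \<in> \<Sigma> (map t [n..<m'])" "f \<in> val s'" for m m' s s'
  proof -
    have d: "dom f \<subseteq> (\<Union>r\<in>set (map t [n..<m]). {m_dn r..<m_up r})"
      using restr[OF dm[OF m(1)] s] by simp
    have "t m \<in> set (map t [n..<m'])" using m by auto
    moreover have "\<forall>r\<in>set (map t [n..<m']). f |` {m_dn r..<m_up r} \<in> val r"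
      using restr[OF dm[OF less_trans[OF m]] s'] by simp
    ultimately have "f |` {m_dn (t m)..<m_up (t m)} \<in> val (t m)" by (meson bspec)
    moreover have "val (t m) \<subseteq> FH H"
      using FP[of m] unfolding FP_creature_def by simp
    ultimately have "dom (f |` {m_dn (t m)..<m_up (t m)}) \<noteq> {}"
      unfolding FH_def by blast
    then obtain x where x: "x \<in> dom f" "m_dn (t m) \<le> x"
      unfolding dom_restrict by fastforce
    from subsetD[OF d x(1)] obtain i where "i < m" "x < m_up (t i)" by auto
    with mono[of i m] x(2) show False by simp
  qed
  show "m = m'" if "n < m \<and> (\<exists>s\<in>\<Sigma> (map t [n..<m]). f \<in> val s)"
    "n < m' \<and> (\<exists>s\<in>\<Sigma> (map t [n..<m']). f \<in> val s)" for m m'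
  proof (rule ccontr)
    assume "m \<noteq> m'"
    then consider "m < m'" | "m' < m" by linarith
    then show False using no that by cases blast+
  qed
qed

end

theory Submission
  imports Defs
begin

text \<open>
  This is the Galvin--Glazer argument. Replace a set \<open>A \<in> D\<^sub>n\<close> by the set
  \<open>A\<^sup>*\<close> of those \<open>f \<in> A\<close> with \<open>f \<circledast> A \<in> D\<^bsub>x\<^sub>f\<^esub>\<close>; idempotence of \<open>D\<close> gives
  \<open>A\<^sup>* \<in> D\<^sub>n\<close> and \<open>f \<circledast> A\<^sup>* \<in> D\<^bsub>x\<^sub>f\<^esub>\<close> for all \<open>f \<in> A\<^sup>*\<close>. Since \<open>D\<close> contains the families \<open>B_fam\<close>, every
  member of \<open>D\<^sub>n\<close> includes \<open>val s\<close> for some \<open>s \<in> \<Sigma>\<^sup>t\<^sup>t(t \<upharpoonleft> n)\<close> of arbitrarily large norm. So one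
  chooses the \<open>s\<^sub>j\<close> one after the other, with \<open>val s\<^sub>j\<close> included in \<open>A\<^sub>k\<^sup>*\<close>, for \<open>k\<close> the place where
  \<open>s\<^sub>j\<close> starts, and in \<open>f \<circledast> A\<^sub>n\<^sup>*\<close> for the finitely many unions \<open>f\<close> of members of the values
  chosen before.
\<close>

section \<open>The axioms of a tight pair, and segments of \<open>t\<close>\<close>

locale creature_sequence =
  fixes H :: "nat \<Rightarrow> 'v set"
    and K :: "('v, 'd) creature set"
    and \<Sigma> :: "('v, 'd) creature list \<Rightarrow> ('v, 'd) creature set"
    and t :: "nat \<Rightarrow> ('v, 'd) creature"
  assumes tight: "tight_FFCC H K \<Sigma>"
    and t: "t \<in> PC_tt K"
begin

abbreviation pos :: "nat \<Rightarrow> 'v pfun set" where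
  "pos n \<equiv> pos_tt \<Sigma> (shift t n)"

text \<open>The piece of \<open>pos n\<close> on which \<open>x_of\<close> takes the value
  \<open>m\<close>. Keeping \<open>m\<close> explicit lets most proofs avoid the definite
  description.\<close>

abbreviation pos_between :: "nat \<Rightarrow> nat \<Rightarrow> 'v pfun set" where
  "pos_between n m \<equiv> (\<Union>s\<in>\<Sigma> (map t [n..<m]). val s)"

lemma creature: "s \<in> K \<Longrightarrow> FP_creature H s"
proof -
  have "\<forall>s\<in>K. FP_creature H s" using tight unfolding tight_FFCC_def by (elim conjE)
  then show "s \<in> K \<Longrightarrow> FP_creature H s" ..
qed

lemma finite_val: "s \<in> K \<Longrightarrow> finite (val s)"
  using creature unfolding FP_creature_def by blast

lemma m_dn_less_m_up: "s \<in> K \<Longrightarrow> m_dn s < m_up s"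
  using creature unfolding FP_creature_def by blast

lemma Sigma_domI: "s \<in> \<Sigma> ts \<Longrightarrow> ts \<in> Sigma_dom K"
proof -
  have "\<forall>ts. ts \<notin> Sigma_dom K \<longrightarrow> \<Sigma> ts = {}"
    using tight unfolding tight_FFCC_def by (elim conjE)
  then show "s \<in> \<Sigma> ts \<Longrightarrow> ts \<in> Sigma_dom K" by blast
qed

lemma Sigma_subset: "\<Sigma> ts \<subseteq> K"
proof -
  have "\<forall>ts\<in>Sigma_dom K. \<Sigma> ts \<noteq> {} \<and> \<Sigma> ts \<subseteq> K"
    using tight unfolding tight_FFCC_def by (elim conjE)
  then show ?thesis using Sigma_domI by blast
qed

lemma
  assumes "s \<in> \<Sigma> ts"
  shows Sigma_m_dn: "m_dn s = m_dn (hd ts)"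
    and Sigma_m_up: "m_up s = m_up (last ts)"
    and val_Sigma_restrict: "f \<in> val s \<Longrightarrow> r \<in> set ts \<Longrightarrow> f |` {m_dn r..<m_up r} \<in> val r"
proof -
  have "\<forall>ts\<in>Sigma_dom K. \<forall>t\<in>\<Sigma> ts.
        m_dn t = m_dn (hd ts) \<and> m_up t = m_up (last ts) \<and>
        (\<forall>f\<in>val t. dom f \<subseteq> (\<Union>r\<in>set ts. {m_dn r..<m_up r}) \<and>
                   (\<forall>r\<in>set ts. f |` {m_dn r..<m_up r} \<in> val r))"
    using tight unfolding tight_FFCC_def by (elim conjE)
  note * = this[THEN bspec, OF Sigma_domI[OF assms], THEN bspec, OF assms]
  from * show "m_dn s = m_dn (hd ts)" "m_up s = m_up (last ts)" by blast+
  from * show "f \<in> val s \<Longrightarrow> r \<in> set ts \<Longrightarrow> f |` {m_dn r..<m_up r} \<in> val r" by blast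
qed

lemma Sigma_concat:
  assumes "tss \<noteq> []" "set tss \<subseteq> Sigma_dom K" "concat tss \<in> Sigma_dom K"
    and "list_all2 (\<lambda>s ts. s \<in> \<Sigma> ts) ss tss"
  shows "\<Sigma> ss \<subseteq> \<Sigma> (concat tss)"
proof -
  have "\<forall>tss ss. tss \<noteq> [] \<and> set tss \<subseteq> Sigma_dom K \<and> concat tss \<in> Sigma_dom K \<and>
        list_all2 (\<lambda>s ts. s \<in> \<Sigma> ts) ss tss \<longrightarrow> \<Sigma> ss \<subseteq> \<Sigma> (concat tss)"
    using tight unfolding tight_FFCC_def by (elim conjE)
  then show ?thesis using assms by meson
qed

lemma Sigma_pair:
  assumes "s0 \<in> K" "s1 \<in> K" "m_up s0 = m_dn s1" "f0 \<in> val s0" "f1 \<in> val s1"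
  shows "\<exists>s\<in>\<Sigma> [s0, s1]. f0 ++ f1 \<in> val s"
proof -
  have "\<forall>s0\<in>K. \<forall>s1\<in>K. m_up s0 = m_dn s1 \<longrightarrow>
        (\<forall>f0\<in>val s0. \<forall>f1\<in>val s1. \<exists>s\<in>\<Sigma> [s0, s1]. f0 ++ f1 \<in> val s)"
    using tight unfolding tight_FFCC_def by (elim conjE)
  then show ?thesis using assms by blast
qed

lemma t_in_K: "t n \<in> K"
  and t_step: "m_up (t n) = m_dn (t (Suc n))"
  using t unfolding PC_tt_def by auto

lemma inj_m_dn: "inj (\<lambda>n. m_dn (t n))"
proof (rule strict_mono_imp_inj_on)
  show "strict_mono (\<lambda>n. m_dn (t n))"
    unfolding strict_mono_Suc_iff using m_dn_less_m_up[OF t_in_K] t_step by simp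
qed

lemma segment_in_dom: "n < m \<Longrightarrow> map t [n..<m] \<in> Sigma_dom K"
  using t_in_K t_step by (auto simp: Sigma_dom_def matching_def)

lemma segment_less: "s \<in> \<Sigma> (map t [n..<m]) \<Longrightarrow> n < m"
  using Sigma_domI by (fastforce simp: Sigma_dom_def)

lemma segment_m_dn: "s \<in> \<Sigma> (map t [n..<m]) \<Longrightarrow> m_dn s = m_dn (t n)"
  using Sigma_m_dn segment_less by (fastforce simp: hd_map)

lemma segment_m_up: "s \<in> \<Sigma> (map t [n..<m]) \<Longrightarrow> m_up s = m_dn (t m)"
proof -
  assume s: "s \<in> \<Sigma> (map t [n..<m])"
  then have "n < m" by (rule segment_less)
  then show ?thesis
    using Sigma_m_up[OF s] t_step[of "m - 1"] by (simp add: last_map)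
qed

text \<open>All \<open>m\<close> are allowed: for \<open>m \<le> n\<close> the segment is empty,
  hence outside the domain, and \<open>\<Sigma>\<close> has the value \<open>{}\<close>
  there.\<close>

lemma Sigma_tt_shift: "Sigma_tt \<Sigma> (shift t n) = (\<Union>m. \<Sigma> (map t [n..<m]))"
proof -
  have eq: "map (shift t n) [0..<Suc k] = map t [n..<n + Suc k]" for k
    by (rule nth_equalityI) (auto simp: shift_def simp del: upt_Suc)
  have "\<exists>k. s \<in> \<Sigma> (map t [n..<n + Suc k])" if "s \<in> \<Sigma> (map t [n..<m])" for s m
    using that less_imp_Suc_add[OF segment_less[OF that]] by auto
  then show ?thesis
    unfolding Sigma_tt_def eq by blast
qed

lemma pos_eq: "pos n = (\<Union>m. pos_between n m)"
  unfolding pos_tt_def Sigma_tt_shift by blast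

lemma pos_between_subset: "pos_between n m \<subseteq> pos n"
  unfolding pos_eq by blast

lemma x_of_eq:
  assumes "f \<in> pos_between n m"
  shows "x_of \<Sigma> t n f = m"
  unfolding x_of_def
proof (rule the1_equality)
  show "\<exists>!m. n < m \<and> (\<exists>s\<in>\<Sigma> (map t [n..<m]). f \<in> val s)"
    using x_of_unique[OF tight t] assms pos_between_subset by blast
  show "n < m \<and> (\<exists>s\<in>\<Sigma> (map t [n..<m]). f \<in> val s)"
    using assms segment_less by blast
qed

lemma pos_between_x_of: "f \<in> pos n \<Longrightarrow> f \<in> pos_between n (x_of \<Sigma> t n f)"
  unfolding pos_eq using x_of_eq by fastforce

lemma f_conv_eq:
  "f \<in> pos_between n m \<Longrightarrow> f_conv \<Sigma> t n f A = {g \<in> pos m. f ++ g \<in> A}"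
  unfolding f_conv_def using x_of_eq by simp

text \<open>The pair axiom puts \<open>f ++ g\<close> into the value of some
  \<open>q \<in> \<Sigma> [s, r]\<close>, and the concatenation axiom makes \<open>q\<close> a
  creature over the whole segment.\<close>

lemma pos_between_trans:
  assumes f: "f \<in> pos_between n m" and g: "g \<in> pos_between m p"
  shows "f ++ g \<in> pos_between n p"
proof -
  obtain s where s: "s \<in> \<Sigma> (map t [n..<m])" "f \<in> val s" using f by blast
  obtain r where r: "r \<in> \<Sigma> (map t [m..<p])" "g \<in> val r" using g by blast
  have less: "n < m" "m < p" using segment_less s r by blast+
  have eq: "concat [map t [n..<m], map t [m..<p]] = map t [n..<p]"
    using less upt_add_eq_append[of n m "p - m"] by simp
  have "\<Sigma> [s, r] \<subseteq> \<Sigma> (map t [n..<p])"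
    using Sigma_concat[of "[map t [n..<m], map t [m..<p]]" "[s, r]"] segment_in_dom less s r
    unfolding eq by simp
  moreover have "\<exists>q\<in>\<Sigma> [s, r]. f ++ g \<in> val q"
    using Sigma_pair s r Sigma_subset segment_m_up segment_m_dn by (metis subsetD)
  ultimately show ?thesis by blast
qed

section \<open>Idempotence and the starred sets\<close>

definition star :: "(nat \<Rightarrow> 'v pfun set set) \<Rightarrow> nat \<Rightarrow> 'v pfun set \<Rightarrow> 'v pfun set" where
  "star D n A = A \<inter> set_conv \<Sigma> t n A D"

lemma set_conv_in:
  assumes "suf_prod \<Sigma> t D D = D" "A \<in> D n"
  shows "set_conv \<Sigma> t n A D \<in> D n"
proof -
  have "A \<in> suf_prod \<Sigma> t D D n" using assms by simp
  then show ?thesis unfolding suf_prod_def by simp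
qed

text \<open>Associativity of \<open>++\<close>: if \<open>g\<close> ends at \<open>p\<close>, so
  does \<open>f ++ g\<close>, and both sides ask that the \<open>h \<in> pos p\<close> with
  \<open>f ++ g ++ h \<in> A\<close> form a member of \<open>D p\<close>.\<close>

lemma f_conv_set_conv:
  assumes f: "f \<in> pos_between n m"
  shows "f_conv \<Sigma> t n f (set_conv \<Sigma> t n A D) = set_conv \<Sigma> t m (f_conv \<Sigma> t n f A) D"
proof -
  have "f ++ g \<in> set_conv \<Sigma> t n A D \<longleftrightarrow> g \<in> set_conv \<Sigma> t m (f_conv \<Sigma> t n f A) D"
    if g: "g \<in> pos m" for g
  proof -
    define p where "p = x_of \<Sigma> t m g"
    have gp: "g \<in> pos_between m p" using pos_between_x_of[OF g] by (simp add: p_def)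
    note fg = pos_between_trans[OF f gp]
    \<comment> \<open>The nested \<open>f_conv\<close> also demands
      \<open>g ++ h \<in> pos m\<close>, a condition absent from the one for
      \<open>f ++ g\<close>.\<close>
    have "g ++ h \<in> pos m" if "h \<in> pos p" for h
      using pos_between_trans[OF gp pos_between_x_of[OF that]] pos_between_subset by blast
    then have "f_conv \<Sigma> t n (f ++ g) A = f_conv \<Sigma> t m g (f_conv \<Sigma> t n f A)"
      unfolding f_conv_eq[OF f] f_conv_eq[OF gp] f_conv_eq[OF fg] by auto
    moreover have "f ++ g \<in> pos n" using fg pos_between_subset by blast
    ultimately show ?thesis
      unfolding set_conv_def using g x_of_eq[OF fg] by (simp add: p_def)
  qed
  moreover have "set_conv \<Sigma> t m (f_conv \<Sigma> t n f A) D \<subseteq> pos m"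
    unfolding set_conv_def by blast
  ultimately show ?thesis unfolding f_conv_eq[OF f, of "set_conv \<Sigma> t n A D"] by blast
qed

lemma
  assumes "D \<in> suf_star \<Sigma> t"
  shows suf_empty: "{} \<notin> D n"
    and suf_Int: "A \<in> D n \<Longrightarrow> B \<in> D n \<Longrightarrow> A \<inter> B \<in> D n"
proof -
  have "ultrafilter_on (pos n) (D n)" using assms unfolding suf_star_def suf_def by blast
  then have "{} \<notin> D n \<and> (\<forall>A\<in>D n. \<forall>B\<in>D n. A \<inter> B \<in> D n)"
    unfolding ultrafilter_on_def by (elim conjE) (intro conjI)
  then show "{} \<notin> D n" "A \<in> D n \<Longrightarrow> B \<in> D n \<Longrightarrow> A \<inter> B \<in> D n" by auto
qed

text \<open>The factor \<open>A\<close> covers empty \<open>I\<close>, where the intersection over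
  \<open>I\<close> is \<open>UNIV\<close>.\<close>

lemma suf_Inter:
  assumes "D \<in> suf_star \<Sigma> t" "finite I" "A \<in> D n" "\<And>i. i \<in> I \<Longrightarrow> B i \<in> D n"
  shows "A \<inter> (\<Inter>i\<in>I. B i) \<in> D n"
  using assms(2,4)
proof (induction I rule: finite_induct)
  case (insert i I)
  then have "B i \<inter> (A \<inter> (\<Inter>i\<in>I. B i)) \<in> D n" using suf_Int[OF assms(1)] by simp
  then show ?case by (simp add: Int_left_commute)
qed (use assms in simp)

lemma star_in:
  assumes "D \<in> suf_star \<Sigma> t" "suf_prod \<Sigma> t D D = D" "A \<in> D n"
  shows "star D n A \<in> D n"
  unfolding star_def using assms set_conv_in suf_Int by blast

text \<open>\<open>f_conv\<close> commutes with intersections. Its value at \<open>A\<close> is in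
  \<open>D m\<close> since \<open>f\<close> is in \<open>set_conv\<close>; its value at
  \<open>set_conv\<close> is \<open>set_conv\<close> of the first value, so idempotence
  applies.\<close>

lemma f_conv_star_in:
  assumes D: "D \<in> suf_star \<Sigma> t" "suf_prod \<Sigma> t D D = D"
    and f: "f \<in> star D n A" "f \<in> pos_between n m"
  shows "f_conv \<Sigma> t n f (star D n A) \<in> D m"
proof -
  have "f_conv \<Sigma> t n f (star D n A) =
      f_conv \<Sigma> t n f A \<inter> f_conv \<Sigma> t n f (set_conv \<Sigma> t n A D)"
    unfolding star_def f_conv_def by blast
  moreover have "f_conv \<Sigma> t n f A \<in> D m"
    using f(1) x_of_eq[OF f(2)] unfolding star_def set_conv_def by simp
  ultimately show ?thesis
    using f_conv_set_conv[OF f(2)] set_conv_in[OF D(2)] suf_Int[OF D(1)] by metis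
qed

text \<open>Otherwise \<open>pos n - B\<close> meets \<open>val s\<close> for every \<open>s\<close>
  of norm at least \<open>M\<close>, so it belongs to \<open>B_fam\<close>, hence to
  \<open>D n\<close>, together with the disjoint set \<open>B\<close>.\<close>

lemma large_creature_inside:
  assumes D: "D \<in> suf_star \<Sigma> t" and B: "B \<in> D n"
  obtains m s where "s \<in> \<Sigma> (map t [n..<m])" "M \<le> nor s" "val s \<subseteq> B"
proof -
  have "\<exists>s\<in>Sigma_tt \<Sigma> (shift t n). M \<le> nor s \<and> val s \<subseteq> B"
  proof (rule ccontr)
    assume none: "\<not> ?thesis"
    have "val s \<inter> (pos n - B) \<noteq> {}" if "s \<in> Sigma_tt \<Sigma> (shift t n)" "M \<le> nor s" for s
    proof -
      have "val s \<subseteq> pos n" using that unfolding pos_tt_def by blast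
      then show ?thesis using none that by blast
    qed
    then have "pos n - B \<in> B_fam \<Sigma> t n" unfolding B_fam_def by blast
    then have "pos n - B \<in> D n" using D unfolding suf_star_def by blast
    then have "B \<inter> (pos n - B) \<in> D n" using suf_Int[OF D B] by blast
    then show False using suf_empty[OF D] by simp
  qed
  then show ?thesis using that unfolding Sigma_tt_shift by blast
qed

section \<open>Stagewise construction of the creatures\<close>

text \<open>A stage \<open>(s, k, m, F)\<close> of the construction consists of a creature \<open>s\<close> built from
  \<open>t\<^sub>k, \<dots>, t\<^bsub>m-1\<^esub>\<close> and the finite set \<open>F\<close> of all \<open>(n, f)\<close> for which \<open>f\<close> is a union of members of
  the values of consecutive chosen creatures, starting at \<open>n\<close> and ending with \<open>s\<close>.\<close>

definition stage ::
  "(nat \<Rightarrow> 'v pfun set) \<Rightarrow> nat \<Rightarrow>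
   ('v, 'd) creature \<times> nat \<times> nat \<times> (nat \<times> 'v pfun) set \<Rightarrow> bool" where
  "stage B j = (\<lambda>(s, k, m, F).
     s \<in> \<Sigma> (map t [k..<m]) \<and> real j \<le> nor s \<and> (j = 0 \<longrightarrow> k = 0) \<and>
     finite F \<and> (\<forall>(n, f)\<in>F. f \<in> B n \<inter> pos_between n m) \<and> Pair k ` val s \<subseteq> F)"

text \<open>Along a chain of stages, this closure condition and the last clause of
  \<open>stage\<close> put every union of consecutive values ending at the current creature into
  \<open>F\<close>.\<close>

definition next_stage ::
  "('v, 'd) creature \<times> nat \<times> nat \<times> (nat \<times> 'v pfun) set \<Rightarrow>
   ('v, 'd) creature \<times> nat \<times> nat \<times> (nat \<times> 'v pfun) set \<Rightarrow> bool" where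
  "next_stage = (\<lambda>(s, k, m, F) (s', k', m', F').
     k' = m \<and> (\<forall>(n, f)\<in>F. \<forall>g\<in>val s'. (n, f ++ g) \<in> F'))"

lemma stage_0:
  assumes "D \<in> suf_star \<Sigma> t" "B 0 \<in> D 0"
  shows "\<exists>x. stage B 0 x"
proof -
  obtain m s where s: "s \<in> \<Sigma> (map t [0..<m])" "0 \<le> nor s" "val s \<subseteq> B 0"
    using large_creature_inside[OF assms] by blast
  then have "stage B 0 (s, 0, m, Pair 0 ` val s)"
    using finite_val Sigma_subset unfolding stage_def by fastforce
  then show ?thesis ..
qed

lemma stage_Suc:
  assumes D: "D \<in> suf_star \<Sigma> t"
    and B: "\<And>n. B n \<in> D n"
    and B_conv: "\<And>n m f. f \<in> B n \<Longrightarrow> f \<in> pos_between n m \<Longrightarrow> f_conv \<Sigma> t n f (B n) \<in> D m"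
    and x: "stage B j x"
  shows "\<exists>y. stage B (Suc j) y \<and> next_stage x y"
proof -
  obtain s k m F where x_eq: "x = (s, k, m, F)" using prod_cases4 by blast
  have fin: "finite F" and F: "\<And>n f. (n, f) \<in> F \<Longrightarrow> f \<in> B n \<and> f \<in> pos_between n m"
    using x unfolding x_eq stage_def by auto
  \<comment> \<open>A value chosen next prolongs every \<open>f\<close> in \<open>F\<close>, where
    the result must stay in \<open>B n\<close>, and also starts unions of its own at
    \<open>m\<close>, which requires \<open>B m\<close>.\<close>
  define C where "C = B m \<inter> (\<Inter>(n, f)\<in>F. f_conv \<Sigma> t n f (B n))"
  have "C \<in> D m"
    unfolding C_def
  proof (rule suf_Inter[OF D fin B])
    show "(case p of (n, f) \<Rightarrow> f_conv \<Sigma> t n f (B n)) \<in> D m" if "p \<in> F" for p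
    proof (cases p)
      case (Pair n f)
      then show ?thesis using F B_conv that by simp
    qed
  qed
  then obtain p r where r: "r \<in> \<Sigma> (map t [m..<p])" "real (Suc j) \<le> nor r" "val r \<subseteq> C"
    using large_creature_inside[OF D] by blast
  \<comment> \<open>The prolonged old unions, and those that begin with \<open>r\<close>.\<close>
  define G where "G = (\<lambda>((n, f), g). (n, f ++ g)) ` (F \<times> val r) \<union> Pair m ` val r"
  have "finite G"
    using fin r finite_val Sigma_subset unfolding G_def by blast
  have "f ++ g \<in> B n \<and> f ++ g \<in> pos_between n p"
    if "(n, f) \<in> F" "g \<in> val r" for n f g
  proof
    have "g \<in> f_conv \<Sigma> t n f (B n)" using that r(3) unfolding C_def by blast
    then show "f ++ g \<in> B n" unfolding f_conv_def by blast
    have "g \<in> pos_between m p" using that r(1) by blast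
    with F[OF that(1), THEN conjunct2] show "f ++ g \<in> pos_between n p"
      by (rule pos_between_trans)
  qed
  moreover have "g \<in> B m \<and> g \<in> pos_between m p" if "g \<in> val r" for g
    using that r(1,3) unfolding C_def by blast
  ultimately have "\<forall>(n, f)\<in>G. f \<in> B n \<inter> pos_between n p"
    unfolding G_def by auto
  then have "stage B (Suc j) (r, m, p, G)"
    using r \<open>finite G\<close> unfolding stage_def by (auto simp: G_def)
  moreover have "next_stage x (r, m, p, G)"
    unfolding x_eq next_stage_def G_def by (auto intro!: image_eqI)
  ultimately show ?thesis by blast
qed

end

section \<open>Cutting positions of \<open>s\<close> into blocks, and the conclusion\<close>

lemma restrict_map_append:
  fixes a b c :: nat
  assumes "a \<le> b" "b \<le> c"
  shows "f |` {a..<b} ++ f |` {b..<c} = f |` {a..<c}"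
  using assms by (auto simp: fun_eq_iff map_add_def restrict_map_def split: option.split)

lemma restrict_map_superset: "dom f \<subseteq> S \<Longrightarrow> f |` S = f"
  by (rule ext) (metis domIff restrict_map_def subsetD)

theorem theorem3p7:
  fixes H :: "nat \<Rightarrow> 'v set"
    and K :: "('v, 'd) creature set"
    and \<Sigma> :: "('v, 'd) creature list \<Rightarrow> ('v, 'd) creature set"
    and t :: "nat \<Rightarrow> ('v, 'd) creature"
    and D :: "nat \<Rightarrow> 'v pfun set set"
    and A :: "nat \<Rightarrow> 'v pfun set"
  assumes "\<And>i. finite (H i) \<and> H i \<noteq> {}"
    and "tight_FFCC H K \<Sigma>"
    and "t \<in> PC_tt K"
    and "D \<in> suf_star \<Sigma> t"
    and "suf_prod \<Sigma> t D D = D"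
    and "\<And>n. A n \<in> D n"
  shows "\<exists>s\<in>PC_tt K. PC_le \<Sigma> t s \<and> m_dn (s 0) = m_dn (t 0) \<and>
           (\<forall>i k. s i \<in> Sigma_tt \<Sigma> (shift t k) \<longrightarrow> pos_tt \<Sigma> (shift s i) \<subseteq> A k)"
proof -
  interpret creature_sequence H K \<Sigma> t by unfold_locales fact+
  \<comment> \<open>Passing to the starred sets secures the prolongation hypothesis of
    \<open>stage_Suc\<close>.\<close>
  define B where "B n = star D n (A n)" for n
  have B: "B n \<in> D n" for n
    unfolding B_def using star_in assms by blast
  have B_conv: "f_conv \<Sigma> t n f (B n) \<in> D m" if "f \<in> B n" "f \<in> pos_between n m" for n m f
    using f_conv_star_in assms(4,5) that unfolding B_def by blast
  have "\<exists>X. \<forall>j. stage B j (X j) \<and> next_stage (X j) (X (Suc j))"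
  proof (rule dependent_nat_choice)
    show "\<exists>x. stage B 0 x" using assms(4) B by (rule stage_0)
    show "\<exists>y. stage B (Suc j) y \<and> next_stage x y" if "stage B j x" for x j
      using assms(4) B B_conv that by (rule stage_Suc)
  qed
  then obtain X where X: "\<And>j. stage B j (X j)" "\<And>j. next_stage (X j) (X (Suc j))"
    by blast
  define s where "s j = fst (X j)" for j
  define k where "k j = fst (snd (X j))" for j
  define F where "F j = snd (snd (snd (X j)))" for j
  \<comment> \<open>\<open>next_stage\<close> makes the end of block \<open>j\<close> the start of
    block \<open>Suc j\<close>, so the one sequence \<open>k\<close> records both.\<close>
  have X_eq: "X j = (s j, k j, k (Suc j), F j)" for j
    using X(2)[of j] unfolding next_stage_def s_def k_def F_def by (auto split: prod.splits)
  have s: "s j \<in> \<Sigma> (map t [k j..<k (Suc j)])" and nor_s: "real j \<le> nor (s j)"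
    and F_B: "(n, f) \<in> F j \<Longrightarrow> f \<in> B n"
    and F_start: "g \<in> val (s j) \<Longrightarrow> (k j, g) \<in> F j" for j n f g
    using X(1)[of j] unfolding X_eq stage_def by auto
  have F_step: "(n, f ++ g) \<in> F (Suc j)" if "(n, f) \<in> F j" "g \<in> val (s (Suc j))" for n f g j
    using X(2)[of j] that unfolding X_eq next_stage_def by auto
  have k0: "k 0 = 0" using X(1)[of 0] unfolding X_eq stage_def by simp
  have k_less: "k j < k (Suc j)" for j using segment_less s by blast
  have s_K: "s j \<in> K" for j using s Sigma_subset by blast
  have s_dn: "m_dn (s j) = m_dn (t (k j))" for j using segment_m_dn s by blast
  have s_step: "m_up (s j) = m_dn (s (Suc j))" for j using segment_m_up s s_dn by metis
  have "filterlim (\<lambda>j. nor (s j)) at_top sequentially"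
    using filterlim_real_sequentially by (rule filterlim_at_top_mono) (simp add: nor_s)
  then have s_PC: "s \<in> PC_tt K" using s_K s_step unfolding PC_tt_def by blast
  \<comment> \<open>The positions of \<open>s\<close> come from segments of \<open>s\<close>, so the
    segment lemmas are needed for \<open>s\<close> as well as for \<open>t\<close>.\<close>
  interpret s: creature_sequence H K \<Sigma> s by unfold_locales fact+
  have "PC_le \<Sigma> t s"
    unfolding PC_le_def
  proof (intro exI[of _ "\<lambda>j. {k j..<k (Suc j)}"] conjI allI)
    fix j
    have "Max {k j..<k (Suc j)} < k (Suc j)" using k_less[of j] by (subst Max_less_iff) auto
    also have "\<dots> = Min {k (Suc j)..<k (Suc (Suc j))}"
      using k_less[of "Suc j"] by (intro Min_eqI[symmetric]) auto
    finally show "Max {k j..<k (Suc j)} < Min {k (Suc j)..<k (Suc (Suc j))}" .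
  qed (use k_less s in auto)
  \<comment> \<open>Cut \<open>f\<close> at the block boundaries: each piece is in the value of its
    block, so by \<open>F_start\<close> and \<open>F_step\<close> the initial unions of pieces are
    in \<open>F l\<close>; at \<open>l = m - 1\<close> the union is \<open>f\<close>.\<close>
  moreover have "f \<in> A (k i)" if f: "f \<in> pos_tt \<Sigma> (shift s i)" for i f
  proof -
    obtain m r where r: "r \<in> \<Sigma> (map s [i..<m])" "f \<in> val r"
      using f unfolding s.pos_eq by blast
    have part: "f |` {m_dn (s l)..<m_up (s l)} \<in> val (s l)" if "i \<le> l" "l < m" for l
      using val_Sigma_restrict[OF r(1) r(2)] that by simp
    \<comment> \<open>The inequality serves \<open>restrict_map_append\<close>; the guard
      \<open>l < m\<close> is there because the induction bounds \<open>l\<close> only from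
      below.\<close>
    have "m_dn (s i) < m_up (s l) \<and>
        (l < m \<longrightarrow> (k i, f |` {m_dn (s i)..<m_up (s l)}) \<in> F l)" if "i \<le> l" for l
      using that
    proof (induction l rule: dec_induct)
      case base
      then show ?case using part F_start m_dn_less_m_up[OF s_K] by simp
    next
      case (step l)
      have "m_up (s l) < m_up (s (Suc l))" using s_step m_dn_less_m_up[OF s_K] by simp
      moreover from this step
      have "f |` {m_dn (s i)..<m_up (s l)} ++ f |` {m_up (s l)..<m_up (s (Suc l))} =
          f |` {m_dn (s i)..<m_up (s (Suc l))}"
        by (intro restrict_map_append) auto
      ultimately show ?case
        using step F_step[of "k i" _ l] part[of "Suc l"] s_step[of l] by fastforce
    qed
    from this[of "m - 1"]
    have "(k i, f |` {m_dn (s i)..<m_up (s (m - 1))}) \<in> F (m - 1)"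
      using s.segment_less[OF r(1)] by simp
    moreover have "f |` {m_dn (s i)..<m_up (s (m - 1))} = f"
    proof -
      have "dom f \<subseteq> {m_dn r..<m_up r}"
        using r Sigma_subset creature unfolding FP_creature_def by blast
      moreover have "m_dn r = m_dn (s i)" "m_up r = m_up (s (m - 1))"
        using s.segment_m_dn[OF r(1)] s.segment_m_up[OF r(1)] s_step[of "m - 1"]
          s.segment_less[OF r(1)] by simp_all
      ultimately show ?thesis using restrict_map_superset by metis
    qed
    ultimately show ?thesis using F_B unfolding B_def star_def by fastforce
  qed
  \<comment> \<open>The lower end of a creature determines where its segment of \<open>t\<close>
    starts, so \<open>k i\<close> is the only index to consider.\<close>
  moreover have "l = k i" if "s i \<in> Sigma_tt \<Sigma> (shift t l)" for i l
  proof -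
    have "m_dn (s i) = m_dn (t l)"
      using that segment_m_dn unfolding Sigma_tt_shift by blast
    then show ?thesis using s_dn inj_m_dn by (metis injD)
  qed
  ultimately have "\<forall>i k. s i \<in> Sigma_tt \<Sigma> (shift t k) \<longrightarrow> pos_tt \<Sigma> (shift s i) \<subseteq> A k"
    by (metis subsetI)
  with \<open>PC_le \<Sigma> t s\<close> show ?thesis
    using s_PC s_dn[of 0] unfolding k0 by (intro bexI[of _ s] conjI)
qed

end
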